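(* Let $\mathbb{F}$ be a field, $d\in\mathbb{N}=\{0,1,2,\dots\}$, and $V$ a $(d+1)$-dimensional $\mathbb{F}$-vector space. Let $\Phi=(A;\{E_i\}_{i=0}^d;A^*;\{E_i^*\}_{i=0}^d)$ be a Leonard system on $V$, and for $0\le i\le d$ let $\theta_i$ be the eigenvalue of $A$ corresponding to $E_i$. Fix a nonzero $\mathbf{v}\in E_0^*V$, and for $(r,s,t)\in\Delta_d$ let $\mathcal{L}_{(r,s,t)}=\eta_r(A)\tau_t(A)\mathbf{v}$. Let $\{U_i\}_{i=0}^d$ denote the $\Phi$-split decomposition of $V$. For $0\le i\le d$ consider the location $\lambda_i=(i,d-i,0)\in\Delta_d$. Then $\mathcal{L}_{\lambda_i}\in U_i$.
   Context: A linear map $V\to V$ is multiplicity-free if it is diagonalizable and every eigenspace has dimension 1. The primitive idempotent of such a map corresponding to an eigenvalue $\theta$ is the linear map acting as the identity on the $\theta$-eigenspace and as $0$ on the other eigenspaces. A Leonard system on $V$ is a sequence $\Phi=(A;\{E_i\}_{i=0}^d;A^*;\{E_i^*\}_{i=0}^d)$ such that: (1) $A,A^*$ are multiplicity-free elements of $\mathrm{End}(V)$; (2) $\{E_i\}_{i=0}^d$ is an ordering of the primitive idempotents of $A$; (3) $\{E_i^*\}_{i=0}^d$ is an ordering of the primitive idempotents of $A^*$; (4) $E_iA^*E_j$ is $0$ if $|i-j|>1$ and is nonzero if $|i-j|=1$; (5) $E_i^*AE_j^*$ is $0$ if $|i-j|>1$ and is nonzero if $|i-j|=1$. The $\Phi$-split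 decomposition $\{U_i\}_{i=0}^d$ of $V$ is defined by $U_i=(E_0^*V+E_1^*V+\cdots+E_i^*V)\cap(E_0V+E_1V+\cdots+E_{d-i}V)$ for $0\le i\le d$. For $0\le k\le d$, $\tau_k(\xi)=\prod_{i=1}^{k}(\xi-\theta_{i-1})$ and $\eta_k(\xi)=\prod_{i=1}^{k}(\xi-\theta_{d-i+1})$, with $\tau_0=\eta_0=1$. $\Delta_d=\{(r,s,t)\mid r,s,t\in\mathbb{N},\ r+s+t=d\}$; its elements are called locations. *)

theory Defs
  imports "HOL-Computational_Algebra.Polynomial" "HOL-Library.Set_Algebras"
begin

text \<open>
  The vector space \<open>V\<close> is a whole type \<open>'v\<close> with an arbitrary scalar multiplication \<open>scale\<close> over
  a field (locale \<^locale>\<open>vector_space\<close>). Elements of \<open>End(V)\<close> are linear functions, multiplied by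
  composition. The families \<open>E\<close>, \<open>Es\<close>, \<open>\<theta>\<close> are functions on \<^typ>\<open>nat\<close> of which only the
  values at indices \<open>0, \<dots>, d\<close> matter.
\<close>

definition eigenspace ::
  "('a::field \<Rightarrow> 'v::ab_group_add \<Rightarrow> 'v) \<Rightarrow> ('v \<Rightarrow> 'v) \<Rightarrow> 'a \<Rightarrow> 'v set" where
  "eigenspace scale A \<mu> = {v. A v = scale \<mu> v}"

definition eigenvalue ::
  "('a::field \<Rightarrow> 'v::ab_group_add \<Rightarrow> 'v) \<Rightarrow> ('v \<Rightarrow> 'v) \<Rightarrow> 'a \<Rightarrow> bool" where
  "eigenvalue scale A \<mu> \<longleftrightarrow> (\<exists>v. v \<noteq> 0 \<and> v \<in> eigenspace scale A \<mu>)"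

definition diagonalizable ::
  "('a::field \<Rightarrow> 'v::ab_group_add \<Rightarrow> 'v) \<Rightarrow> ('v \<Rightarrow> 'v) \<Rightarrow> bool" where
  "diagonalizable scale A \<longleftrightarrow>
     (\<exists>B. \<not> module.dependent scale B \<and> module.span scale B = UNIV \<and>
          (\<forall>b\<in>B. \<exists>\<mu>. b \<in> eigenspace scale A \<mu>))"

definition multiplicity_free ::
  "('a::field \<Rightarrow> 'v::ab_group_add \<Rightarrow> 'v) \<Rightarrow> ('v \<Rightarrow> 'v) \<Rightarrow> bool" where
  "multiplicity_free scale A \<longleftrightarrow>
     diagonalizable scale A \<and>
     (\<forall>\<mu>. eigenvalue scale A \<mu> \<longrightarrow> vector_space.dim scale (eigenspace scale A \<mu>) = 1)"

definition primitive_idempotent ::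
  "('a::field \<Rightarrow> 'v::ab_group_add \<Rightarrow> 'v) \<Rightarrow> ('v \<Rightarrow> 'v) \<Rightarrow> 'a \<Rightarrow> ('v \<Rightarrow> 'v) \<Rightarrow> bool" where
  "primitive_idempotent scale A \<mu> P \<longleftrightarrow>
     eigenvalue scale A \<mu> \<and> Vector_Spaces.linear scale scale P \<and>
     (\<forall>v\<in>eigenspace scale A \<mu>. P v = v) \<and>
     (\<forall>\<nu>. \<nu> \<noteq> \<mu> \<longrightarrow> (\<forall>v\<in>eigenspace scale A \<nu>. P v = 0))"

definition idempotent_ordering ::
  "('a::field \<Rightarrow> 'v::ab_group_add \<Rightarrow> 'v) \<Rightarrow> nat \<Rightarrow> ('v \<Rightarrow> 'v) \<Rightarrow> (nat \<Rightarrow> 'v \<Rightarrow> 'v) \<Rightarrow> bool" where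
  "idempotent_ordering scale d A E \<longleftrightarrow>
     bij_betw E {0..d} {P. \<exists>\<mu>. primitive_idempotent scale A \<mu> P}"

definition leonard_system ::
  "('a::field \<Rightarrow> 'v::ab_group_add \<Rightarrow> 'v) \<Rightarrow> nat \<Rightarrow>
   ('v \<Rightarrow> 'v) \<Rightarrow> (nat \<Rightarrow> 'v \<Rightarrow> 'v) \<Rightarrow> ('v \<Rightarrow> 'v) \<Rightarrow> (nat \<Rightarrow> 'v \<Rightarrow> 'v) \<Rightarrow> bool" where
  "leonard_system scale d A E As Es \<longleftrightarrow>
     Vector_Spaces.linear scale scale A \<and> Vector_Spaces.linear scale scale As \<and>
     multiplicity_free scale A \<and> multiplicity_free scale As \<and>
     idempotent_ordering scale d A E \<and>
     idempotent_ordering scale d As Es \<and>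
     (\<forall>i\<le>d. \<forall>j\<le>d.
        (\<bar>int i - int j\<bar> > 1 \<longrightarrow> E i \<circ> As \<circ> E j = (\<lambda>_. 0)) \<and>
        (\<bar>int i - int j\<bar> = 1 \<longrightarrow> E i \<circ> As \<circ> E j \<noteq> (\<lambda>_. 0))) \<and>
     (\<forall>i\<le>d. \<forall>j\<le>d.
        (\<bar>int i - int j\<bar> > 1 \<longrightarrow> Es i \<circ> A \<circ> Es j = (\<lambda>_. 0)) \<and>
        (\<bar>int i - int j\<bar> = 1 \<longrightarrow> Es i \<circ> A \<circ> Es j \<noteq> (\<lambda>_. 0)))"

text \<open>The sums of subspaces are the elementwise sums of sets of \<^theory>\<open>HOL-Library.Set_Algebras\<close>.\<close>

definition split_decomposition ::
  "nat \<Rightarrow> (nat \<Rightarrow> 'v \<Rightarrow> 'v) \<Rightarrow> (nat \<Rightarrow> 'v \<Rightarrow> 'v) \<Rightarrow> nat \<Rightarrow> 'v::ab_group_add set" where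
  "split_decomposition d E Es i = (\<Sum>h=0..i. range (Es h)) \<inter> (\<Sum>h=0..d-i. range (E h))"

text \<open>The endomorphism \<open>p(A)\<close>, for a polynomial \<open>p\<close> over the field of scalars.\<close>

definition poly_map ::
  "('a::field \<Rightarrow> 'v::ab_group_add \<Rightarrow> 'v) \<Rightarrow> 'a poly \<Rightarrow> ('v \<Rightarrow> 'v) \<Rightarrow> 'v \<Rightarrow> 'v" where
  "poly_map scale p A v = (\<Sum>n\<le>degree p. scale (coeff p n) ((A ^^ n) v))"

definition tau :: "(nat \<Rightarrow> 'a::field) \<Rightarrow> nat \<Rightarrow> 'a poly" where
  "tau \<theta> k = (\<Prod>i=1..k. [:- \<theta> (i - 1), 1:])"

definition eta :: "nat \<Rightarrow> (nat \<Rightarrow> 'a::field) \<Rightarrow> nat \<Rightarrow> 'a poly" where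
  "eta d \<theta> k = (\<Prod>i=1..k. [:- \<theta> (d - i + 1), 1:])"

definition locations :: "nat \<Rightarrow> (nat \<times> nat \<times> nat) set" where
  "locations d = {(r, s, t). r + s + t = d}"

end

theory Submission
  imports Defs
begin

text \<open>
  Since the idempotents \<open>E\<^sub>h\<close> and likewise the \<open>E\<^sup>*\<^sub>h\<close> sum to the identity, a vector lies in
  \<open>E\<^sub>0V + \<dots> + E\<^sub>kV\<close> as soon as the remaining idempotents kill it. The idempotent \<open>E\<^sub>h\<close> kills
  \<open>\<eta>\<^sub>i(A)v\<close> for \<open>h > d - i\<close> because \<open>E\<^sub>h A = \<theta>\<^sub>h E\<^sub>h\<close> and \<open>\<theta>\<^sub>h\<close> is a root of \<open>\<eta>\<^sub>i\<close>. The
  idempotent \<open>E\<^sup>*\<^sub>h\<close> kills it for \<open>h > i\<close> because \<open>A\<close> acts tridiagonally on the \<open>E\<^sup>*\<^sub>jV\<close>, so that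
  each linear factor of \<open>\<eta>\<^sub>i(A)\<close> raises the index at most by one.
\<close>

context vector_space
begin

lemma poly_map_bound:
  assumes "degree p \<le> N"
  shows "poly_map scale p A v = (\<Sum>n\<le>N. scale (coeff p n) ((A ^^ n) v))"
  unfolding poly_map_def
  using assms by (intro sum.mono_neutral_left) (auto simp: coeff_eq_0)

lemma poly_map_1: "poly_map scale 1 A v = v"
  by (simp add: poly_map_def)

text \<open>Multiplying by the indeterminate shifts the coefficients by one place, which amounts to
  applying \<open>A\<close> once more. This lets \<open>eta\<close> be evaluated one linear factor
  at a time.\<close>

lemma poly_map_mult_linear:
  assumes "Vector_Spaces.linear scale scale A"
  shows "poly_map scale (p * [:- c, 1:]) A v =
    A (poly_map scale p A v) - scale c (poly_map scale p A v)"
proof -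
  interpret A: Vector_Spaces.linear scale scale A by fact
  let ?N = "Suc (degree p)"
  have eq: "p * [:- c, 1:] = pCons 0 p - smult c p"
    by simp
  have deg: "degree (pCons 0 p - smult c p) \<le> ?N"
    by (intro degree_diff_le) (auto simp: degree_pCons_le intro: le_trans[OF degree_smult_le])
  have "poly_map scale (p * [:- c, 1:]) A v =
      (\<Sum>n\<le>?N. scale (coeff (pCons 0 p) n) ((A ^^ n) v))
        - (\<Sum>n\<le>?N. scale (c * coeff p n) ((A ^^ n) v))"
    unfolding eq poly_map_bound[OF deg]
    by (simp add: scale_left_diff_distrib sum_subtractf)
  also have "(\<Sum>n\<le>?N. scale (coeff (pCons 0 p) n) ((A ^^ n) v)) = A (poly_map scale p A v)"
    unfolding poly_map_def sum.atMost_Suc_shift by (simp add: A.sum A.scale)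
  also have "(\<Sum>n\<le>?N. scale (c * coeff p n) ((A ^^ n) v)) = scale c (poly_map scale p A v)"
    by (simp add: poly_map_bound[of p ?N] scale_sum_right scale_right_distrib)
  finally show ?thesis .
qed

text \<open>Diagonalizability provides a spanning set of eigenvectors, so identities between linear
  maps need only be checked on eigenvectors.\<close>

lemma linear_eq_if_eq_on_eigenspaces:
  assumes "diagonalizable scale A"
    and "Vector_Spaces.linear scale scale f" "Vector_Spaces.linear scale scale g"
    and "\<And>\<mu> x. x \<in> eigenspace scale A \<mu> \<Longrightarrow> f x = g x"
  shows "f = g"
proof -
  interpret vector_space_pair scale scale ..
  obtain B where "span B = UNIV" "\<forall>b\<in>B. \<exists>\<mu>. b \<in> eigenspace scale A \<mu>"
    using assms(1) by (auto simp: diagonalizable_def)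
  then show ?thesis
    using linear_eq_on_span[OF assms(2,3), of B] assms(4) by (metis UNIV_I ext)
qed

lemma primitive_idempotent_unique:
  assumes "diagonalizable scale A"
    and "primitive_idempotent scale A \<mu> P" "primitive_idempotent scale A \<mu> Q"
  shows "P = Q"
  using assms
  by (intro linear_eq_if_eq_on_eigenspaces[of A]) (auto simp: primitive_idempotent_def, metis)

lemma primitive_idempotent_in_eigenspace:
  assumes "diagonalizable scale A" "Vector_Spaces.linear scale scale A"
    and "primitive_idempotent scale A \<mu> P"
  shows "P x \<in> eigenspace scale A \<mu>"
proof -
  interpret A: Vector_Spaces.linear scale scale A by fact
  interpret P: Vector_Spaces.linear scale scale P
    using assms(3) by (simp add: primitive_idempotent_def)
  interpret vector_space_pair scale scale ..
  have "A \<circ> P = (\<lambda>x. scale \<mu> (P x))"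
  proof (rule linear_eq_if_eq_on_eigenspaces[OF assms(1)])
    show "Vector_Spaces.linear scale scale (A \<circ> P)"
      by (rule Vector_Spaces.linear_compose[OF P.linear_axioms A.linear_axioms])
    show "Vector_Spaces.linear scale scale (\<lambda>x. scale \<mu> (P x))"
      by (rule linear_compose_scale_right[OF P.linear_axioms])
    fix \<nu> y
    assume "y \<in> eigenspace scale A \<nu>"
    then show "(A \<circ> P) y = scale \<mu> (P y)"
      using assms(3) by (cases "\<nu> = \<mu>") (auto simp: primitive_idempotent_def eigenspace_def)
  qed
  then show ?thesis
    by (simp add: eigenspace_def fun_eq_iff)
qed

text \<open>On the eigenspace of \<open>\<mu>\<close> both sides multiply by \<open>\<mu>\<close>;
  on every other eigenspace both vanish.\<close>

lemma primitive_idempotent_comp: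
  assumes "diagonalizable scale A" "Vector_Spaces.linear scale scale A"
    and "primitive_idempotent scale A \<mu> P"
  shows "P (A x) = scale \<mu> (P x)"
proof -
  interpret A: Vector_Spaces.linear scale scale A by fact
  interpret P: Vector_Spaces.linear scale scale P
    using assms(3) by (simp add: primitive_idempotent_def)
  interpret vector_space_pair scale scale ..
  have "P \<circ> A = (\<lambda>x. scale \<mu> (P x))"
  proof (rule linear_eq_if_eq_on_eigenspaces[OF assms(1)])
    show "Vector_Spaces.linear scale scale (P \<circ> A)"
      by (rule Vector_Spaces.linear_compose[OF A.linear_axioms P.linear_axioms])
    show "Vector_Spaces.linear scale scale (\<lambda>x. scale \<mu> (P x))"
      by (rule linear_compose_scale_right[OF P.linear_axioms])
    fix \<nu> y
    assume "y \<in> eigenspace scale A \<nu>"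
    then show "(P \<circ> A) y = scale \<mu> (P y)"
      using assms(3)
      by (cases "\<nu> = \<mu>") (auto simp: primitive_idempotent_def eigenspace_def P.scale)
  qed
  then show ?thesis
    by (simp add: fun_eq_iff)
qed

text \<open>One eigenvector \<open>w j\<close> for each of the \<open>d + 1\<close> distinct
  eigenvalues gives a basis. Since \<open>P h\<close> fixes \<open>w h\<close> and kills the other
  \<open>w j\<close>, the sum of the idempotents fixes this basis.\<close>

lemma sum_primitive_idempotents:
  fixes d :: nat
  assumes dim: "dim (UNIV :: 'b set) = d + 1"
    and P: "\<And>j. j \<le> d \<Longrightarrow> primitive_idempotent scale A (\<mu> j) (P j)"
    and inj: "inj_on \<mu> {..d}"
  shows "(\<Sum>j\<le>d. P j x) = x"
proof -
  interpret vector_space_pair scale scale ..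
  have lin: "Vector_Spaces.linear scale scale (P j)" if "j \<le> d" for j
    using P[OF that] by (simp add: primitive_idempotent_def)
  have "\<exists>w. \<forall>j\<le>d. w j \<noteq> 0 \<and> w j \<in> eigenspace scale A (\<mu> j)"
    using P unfolding primitive_idempotent_def eigenvalue_def by metis
  then obtain w where w: "\<And>j. j \<le> d \<Longrightarrow> w j \<noteq> 0 \<and> w j \<in> eigenspace scale A (\<mu> j)"
    by blast
  have Pw: "P h (w j) = (if h = j then w j else 0)" if "h \<le> d" "j \<le> d" for h j
    using P[OF that(1)] w[OF that(2)] inj_onD[OF inj, of h j] that
    by (cases "h = j") (auto simp: primitive_idempotent_def, metis)
  have inj_w: "inj_on w {..d}"
    by (rule inj_onI) (metis Pw atMost_iff w)
  have indep: "independent (w ` {..d})"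
  proof (rule independent_if_scalars_zero)
    fix f y
    assume sum0: "(\<Sum>y\<in>w ` {..d}. scale (f y) y) = 0" and "y \<in> w ` {..d}"
    then obtain h where h: "h \<le> d" "y = w h"
      by auto
    interpret Ph: Vector_Spaces.linear scale scale "P h"
      using lin h by blast
    \<comment> \<open>Applying \<open>P h\<close> to the vanishing combination isolates the
      coefficient of \<open>w h\<close>.\<close>
    have "0 = P h (\<Sum>j\<le>d. scale (f (w j)) (w j))"
      using sum0 by (simp add: sum.reindex[OF inj_w] Ph.zero)
    also have "\<dots> = (\<Sum>j\<le>d. if h = j then scale (f (w j)) (w j) else 0)"
      unfolding Ph.sum using h by (intro sum.cong) (auto simp: Ph.scale Pw)
    also have "\<dots> = scale (f y) y"
      using h by simp
    finally show "f y = 0"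
      using w h by simp
  qed simp
  obtain B where B: "independent B" "span B = UNIV" "card B = d + 1"
    using basis_exists[of UNIV] dim by (metis top.extremum_uniqueI)
  \<comment> \<open>Infinite sets have cardinality 0, so the positive value \<open>d + 1\<close>
    forces finiteness.\<close>
  have "finite B"
    using B(3) by (simp add: card_ge_0_finite)
  then interpret fin: finite_dimensional_vector_space scale B
    using B by unfold_locales auto
  have span: "span (w ` {..d}) = UNIV"
    using fin.card_ge_dim_independent[of "w ` {..d}" UNIV] indep dim card_image[OF inj_w] by auto
  have "Vector_Spaces.linear scale scale (\<lambda>x. \<Sum>j\<le>d. P j x)"
    using lin by (intro linear_compose_sum) auto
  moreover have "Vector_Spaces.linear scale scale (\<lambda>x. x)"
    by (rule linear_ident)
  moreover have "(\<Sum>j\<le>d. P j y) = y" if "y \<in> w ` {..d}" for y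
  proof -
    from that obtain h where h: "h \<le> d" "y = w h"
      by auto
    then have "(\<Sum>j\<le>d. P j y) = (\<Sum>j\<le>d. if j = h then w h else 0)"
      by (intro sum.cong) (auto simp: Pw)
    with h show ?thesis
      by simp
  qed
  ultimately show ?thesis
    using linear_eq_on_span[of "\<lambda>x. \<Sum>j\<le>d. P j x" "\<lambda>x. x" "w ` {..d}" x] span by blast
qed

text \<open>An eigenvalue determines its primitive idempotent, so a repeated eigenvalue would repeat
  an entry of the ordering.\<close>

lemma idempotent_ordering_inj:
  assumes "diagonalizable scale A" "idempotent_ordering scale d A P"
    and "\<And>j. j \<le> d \<Longrightarrow> primitive_idempotent scale A (\<mu> j) (P j)"
  shows "inj_on \<mu> {..d}"
proof (rule inj_onI)
  fix i j
  assume "i \<in> {..d}" "j \<in> {..d}" "\<mu> i = \<mu> j"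
  then have "P i = P j"
    using primitive_idempotent_unique[OF assms(1)] assms(3) by (metis atMost_iff)
  with \<open>i \<in> {..d}\<close> \<open>j \<in> {..d}\<close> show "i = j"
    using assms(2) by (auto simp: idempotent_ordering_def bij_betw_def inj_on_def)
qed

end

lemma in_sum_range_if_killed:
  fixes P :: "nat \<Rightarrow> 'v \<Rightarrow> 'v::ab_group_add"
  assumes "(\<Sum>j\<le>d. P j x) = x" "k \<le> d"
    and "\<And>h. k < h \<Longrightarrow> h \<le> d \<Longrightarrow> P h x = 0"
  shows "x \<in> (\<Sum>h=0..k. range (P h))"
proof -
  have "(\<Sum>j\<in>{0..k}. P j x) = (\<Sum>j\<le>d. P j x)"
    using assms(2,3) by (intro sum.mono_neutral_left) (auto simp: not_le)
  with assms(1) show ?thesis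
    unfolding set_sum_alt[OF finite_atLeastAtMost]
    by (intro CollectI exI[of _ "\<lambda>j. P j x"]) auto
qed

text \<open>The bound on \<open>k\<close> matters for truncated subtraction: it gives
  \<open>d - Suc k + 1 = d - k\<close>.\<close>

lemma eta_Suc: "k < d \<Longrightarrow> eta d \<theta> (Suc k) = eta d \<theta> k * [:- \<theta> (d - k), 1:]"
  by (simp add: eta_def Suc_diff_Suc mult.commute)

theorem lemma6p4:
  fixes scale :: "'a::field \<Rightarrow> 'v::ab_group_add \<Rightarrow> 'v"
    and d :: nat
    and A As :: "'v \<Rightarrow> 'v"
    and E Es :: "nat \<Rightarrow> 'v \<Rightarrow> 'v"
    and \<theta> :: "nat \<Rightarrow> 'a"
    and v :: 'v
    and L :: "nat \<times> nat \<times> nat \<Rightarrow> 'v"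
    and i :: nat
  assumes "vector_space scale"
    and "vector_space.dim scale (UNIV :: 'v set) = d + 1"
    and "leonard_system scale d A E As Es"
    and "\<And>j. j \<le> d \<Longrightarrow> primitive_idempotent scale A (\<theta> j) (E j)"
    and "v \<in> range (Es 0)" and "v \<noteq> 0"
    and "\<And>r s t. (r, s, t) \<in> locations d \<Longrightarrow>
           L (r, s, t) = poly_map scale (eta d \<theta> r) A
                           (poly_map scale (tau \<theta> t) A v)"
    and "i \<le> d"
  shows "L (i, d - i, 0) \<in> split_decomposition d E Es i"
proof -
  interpret vector_space scale by fact
  note dim = assms(2) and E = assms(4)
  have linA: "Vector_Spaces.linear scale scale A" and linAs: "Vector_Spaces.linear scale scale As"
    and diagA: "diagonalizable scale A" and diagAs: "diagonalizable scale As"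
    and ordE: "idempotent_ordering scale d A E" and ordEs: "idempotent_ordering scale d As Es"
    and tri: "\<And>i j. i \<le> d \<Longrightarrow> j \<le> d \<Longrightarrow> \<bar>int i - int j\<bar> > 1 \<Longrightarrow> Es i \<circ> A \<circ> Es j = (\<lambda>_. 0)"
    using assms(3) by (auto simp: leonard_system_def multiplicity_free_def)
  interpret A: Vector_Spaces.linear scale scale A by fact
  \<comment> \<open>The eigenvalues of \<open>As\<close> are not given by name; they are chosen here
    from the ordering of its idempotents.\<close>
  have "\<exists>\<mu>. primitive_idempotent scale As \<mu> (Es j)" if "j \<le> d" for j
    using ordEs that by (auto simp: idempotent_ordering_def dest: bij_betwE)
  then obtain \<mu> where Es: "\<And>j. j \<le> d \<Longrightarrow> primitive_idempotent scale As (\<mu> j) (Es j)"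
    by metis
  have inj\<mu>: "inj_on \<mu> {..d}"
    by (rule idempotent_ordering_inj[OF diagAs ordEs Es])
  have sumE: "(\<Sum>j\<le>d. E j x) = x" for x
    by (rule sum_primitive_idempotents[OF dim E idempotent_ordering_inj[OF diagA ordE E]])
  have sumEs: "(\<Sum>j\<le>d. Es j x) = x" for x
    by (rule sum_primitive_idempotents[OF dim Es inj\<mu>])
  have linE: "Vector_Spaces.linear scale scale (E h)"
    and linEs: "Vector_Spaces.linear scale scale (Es h)" if "h \<le> d" for h
    using E Es that by (auto simp: primitive_idempotent_def)

  define x where "x k = poly_map scale (eta d \<theta> k) A v" for k
  have x_0: "x 0 = v"
    by (simp add: x_def eta_def poly_map_1)
  have x_Suc: "x (Suc k) = A (x k) - scale (\<theta> (d - k)) (x k)" if "k < d" for k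
    by (simp add: x_def eta_Suc[OF that] poly_map_mult_linear[OF linA] del: mult_pCons_right)

  \<comment> \<open>For \<open>k = 0\<close> the bounds on \<open>h\<close> contradict each other,
    so the induction starts vacuously.\<close>
  have killE: "E h (x k) = 0" if "k \<le> d" "d - k < h" "h \<le> d" for h k
    using that
  proof (induction k)
    case (Suc k)
    interpret Eh: Vector_Spaces.linear scale scale "E h" using linE Suc.prems by blast
    have "E h (x (Suc k)) = scale (\<theta> h) (E h (x k)) - scale (\<theta> (d - k)) (E h (x k))"
      using Suc.prems primitive_idempotent_comp[OF diagA linA E[of h]]
      by (simp add: x_Suc Eh.diff Eh.scale)
    \<comment> \<open>In the first case the new factor has root \<open>\<theta> h\<close> and the
      two terms cancel; in the second the induction hypothesis kills both.\<close>
    moreover have "h = d - k \<or> d - k < h"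
      using Suc.prems by linarith
    ultimately show ?case
      using Suc by auto
  qed simp

  have killEs: "Es h (x k) = 0" if "k < h" "h \<le> d" for h k
    using that
  proof (induction k arbitrary: h)
    case 0
    obtain u where "v = Es 0 u"
      using assms(5) by blast
    then have "v \<in> eigenspace scale As (\<mu> 0)"
      using primitive_idempotent_in_eigenspace[OF diagAs linAs Es[of 0]] by simp
    \<comment> \<open>Here \<open>h > 0\<close>, so \<open>v\<close> lies in an eigenspace of
      \<open>As\<close> that \<open>Es h\<close> annihilates.\<close>
    moreover have "\<mu> 0 \<noteq> \<mu> h"
      using inj\<mu> 0 by (auto simp: inj_on_def)
    ultimately show ?case
      using Es[OF 0(2)] by (simp add: primitive_idempotent_def x_0)
  next
    case (Suc k)
    interpret Eh: Vector_Spaces.linear scale scale "Es h" using linEs Suc.prems by blast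
    \<comment> \<open>The identity is inserted as the sum of the \<open>Es j\<close>. Terms with
      \<open>j > k\<close> vanish by the induction hypothesis; for \<open>j \<le> k\<close> the
      indices satisfy \<open>h - j > 1\<close>, and tridiagonality applies.\<close>
    have "Es h (A (x k)) = (\<Sum>j\<le>d. Es h (A (Es j (x k))))"
      by (subst sumEs[of "x k", symmetric]) (simp add: A.sum Eh.sum)
    also have "\<dots> = 0"
    proof (rule sum.neutral, rule ballI)
      fix j
      assume "j \<in> {..d}"
      show "Es h (A (Es j (x k))) = 0"
      proof (cases "k < j")
        case True
        with Suc.IH \<open>j \<in> {..d}\<close> show ?thesis
          by (simp add: A.zero Eh.zero)
      next
        case False
        with tri[of h j] \<open>j \<in> {..d}\<close> Suc.prems show ?thesis
          by (simp add: fun_eq_iff)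
      qed
    qed
    finally show ?case
      using Suc by (simp add: x_Suc Eh.diff Eh.scale)
  qed

  \<comment> \<open>The last coordinate is 0, so the \<open>tau\<close> factor is 1 and acts as the
    identity on \<open>v\<close>.\<close>
  have "L (i, d - i, 0) = x i"
    using assms(7)[of i "d - i" 0] assms(8) by (simp add: locations_def x_def tau_def poly_map_1)
  moreover have "x i \<in> (\<Sum>h=0..i. range (Es h))"
    using assms(8) by (intro in_sum_range_if_killed[OF sumEs] killEs)
  moreover have "x i \<in> (\<Sum>h=0..d-i. range (E h))"
    using assms(8) by (intro in_sum_range_if_killed[OF sumE] killE) auto
  ultimately show ?thesis
    by (simp add: split_decomposition_def)
qed

end
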